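(* Let $\alpha<0$ and $\beta\in\mathbb{R}$, and let $f\in\mathcal{A}$ satisfy $f(z)f'(z)/z\neq 0$ for all $z\in\mathbb{D}$. If at least one of the following inequalities holds for all $z\in\mathbb{D}$: (i) $\operatorname{Re}\left(\alpha\dfrac{Q_{SD}}{Q_{ST}}+\beta Q_{ST}\right)>0$; (ii) $\operatorname{Re}\left(\alpha\dfrac{Q_{SD}}{Q_{CV}}+\beta Q_{ST}\right)>0$; (iii) $\operatorname{Re}\left(\alpha\dfrac{Q_{SD}}{Q_{ST}}+\beta Q_{CV}\right)>0$; (iv) $\operatorname{Re}\left(\alpha\dfrac{Q_{SD}}{Q_{CV}}+\beta Q_{CV}\right)>0$; then $f$ is starlike.
   Context: $\mathbb{D}=\{z\in\mathbb{C}:|z|<1\}$. $\mathcal{A}$ is the class of analytic functions $f:\mathbb{D}\to\mathbb{C}$ with $f(0)=0$ and $f'(0)=1$. For $f\in\mathcal{A}$, as functions of $z\in\mathbb{D}$: $Q_{ST}=zf'(z)/f(z)$ (with the removable singularity at $z=0$ filled in, value $1$), $Q_{CV}=1+zf''(z)/f'(z)$, and $Q_{SD}=z^2\Big(\big(f''(z)/f'(z)\big)'-\tfrac12\big(f''(z)/f'(z)\big)^2\Big)$ ($z^2$ times the Schwarzian derivative of $f$). The condition $f(z)f'(z)/z\neq0$ is understood at $z=0$ via the removable singularity (where the value is $1$). An inequality containing a quotient is understood to include the requirement that the denominators appearing in it do not vanish in $\mathbb{D}$. A function $f\in\mathcal{A}$ is starlike if $\operatorname{Re}Q_{ST}>0$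 on $\mathbb{D}$; equivalently, $f$ is univalent and $tf(z)\in f(\mathbb{D})$ for all $z\in\mathbb{D}$, $t\in[0,1]$. *)

theory Defs
  imports "HOL-Complex_Analysis.Complex_Analysis"
begin

abbreviation unit_disc :: "complex set" where
  "unit_disc \<equiv> ball 0 1"

text \<open>
  Functions on the unit disc are represented by total functions of type
  \<open>complex \<Rightarrow> complex\<close>, whose values outside the (open) disc are irrelevant below.
\<close>

definition class_A :: "(complex \<Rightarrow> complex) set" where
  "class_A = {f. f holomorphic_on unit_disc \<and> f 0 = 0 \<and> deriv f 0 = 1}"

text \<open>For \<open>f \<in> class_A\<close>, the value 1 at 0 removes the singularity of \<open>z f'(z) / f(z)\<close>.\<close>

definition Q_ST :: "(complex \<Rightarrow> complex) \<Rightarrow> complex \<Rightarrow> complex" where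
  "Q_ST f z = (if z = 0 then 1 else z * deriv f z / f z)"

definition Q_CV :: "(complex \<Rightarrow> complex) \<Rightarrow> complex \<Rightarrow> complex" where
  "Q_CV f z = 1 + z * deriv (deriv f) z / deriv f z"

definition schwarzian :: "(complex \<Rightarrow> complex) \<Rightarrow> complex \<Rightarrow> complex" where
  "schwarzian f z = deriv (\<lambda>w. deriv (deriv f) w / deriv f w) z
      - 1 / 2 * (deriv (deriv f) z / deriv f z)\<^sup>2"

definition Q_SD :: "(complex \<Rightarrow> complex) \<Rightarrow> complex \<Rightarrow> complex" where
  "Q_SD f z = z\<^sup>2 * schwarzian f z"

text \<open>
  The function \<open>f(z) f'(z) / z\<close>; for \<open>f \<in> class_A\<close> its singularity at 0 is removable,
  with value \<open>f'(0)\<^sup>2 = 1\<close>.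
\<close>

definition ff'_over_z :: "(complex \<Rightarrow> complex) \<Rightarrow> complex \<Rightarrow> complex" where
  "ff'_over_z f z = (if z = 0 then 1 else f z * deriv f z / z)"

text \<open>
  The requirement that the denominator of \<open>Q_ST\<close> does not vanish is implied by the
  inequality: if \<open>f z = 0\<close> with \<open>z \<noteq> 0\<close>, then \<open>Q_ST f z = 0\<close>, since \<open>x / 0 = 0\<close>.
  The library constant \<open>starlike\<close> is about sets, hence the different name.
\<close>

definition starlike_fun :: "(complex \<Rightarrow> complex) \<Rightarrow> bool" where
  "starlike_fun f \<longleftrightarrow> f \<in> class_A \<and> (\<forall>z\<in>unit_disc. Re (Q_ST f z) > 0)"

end

theory Submission
  imports Defs
begin

text \<open>
  Write \<open>p\<close> for \<open>Q_ST f\<close> and \<open>q\<close> for \<open>Q_CV f\<close>, and let \<open>\<theta>\<close> be the operator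
  \<open>\<theta> g (z) = z g'(z)\<close>. Two identities reduce the theorem to a statement about \<open>p\<close>:
  \<open>q = p + \<theta> p / p\<close> (logarithmic differentiation), and \<open>Q_SD f = \<theta> q + (1 - q\<^sup>2) / 2\<close>.

  Suppose that \<open>p\<close> does not stay in the right half-plane. Since \<open>p(0) = 1\<close>, there is a point \<open>z\<close>
  of least modulus at which \<open>p\<close> reaches the imaginary axis, say \<open>p(z) = i s\<close>; here \<open>s \<noteq> 0\<close>,
  as \<open>f'\<close> has no zero. On the closed disc of radius \<open>|z|\<close> the real part of \<open>p\<close> is minimal
  at \<open>z\<close>. The first derivatives of \<open>Re p\<close> along the circle and along the radius show that
  \<open>\<theta> p (z) = - m\<close> with \<open>m\<close> real and nonnegative, and the second derivative along the circle,
  which is \<open>- Re (\<theta> (\<theta> p))\<close>, shows that \<open>X = Re (\<theta> (\<theta> p) (z)) \<le> 0\<close>.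

  Hence \<open>q(z) = i t\<close> with \<open>s t = s\<^sup>2 + m > 0\<close>, and in \<open>Q_SD f (z)\<close> all terms are real except
  \<open>\<theta> (\<theta> p) / p\<close>, so that its imaginary part is \<open>- X / s\<close>. Dividing by \<open>i s\<close> or by \<open>i t\<close>
  gives the real parts \<open>- X / s\<^sup>2\<close> and \<open>- X / (s t)\<close>, both nonnegative. After multiplication by
  \<open>\<alpha> < 0\<close> they are at most 0, while \<open>\<beta> p(z)\<close> and \<open>\<beta> q(z)\<close> are purely imaginary: all four
  inequalities fail at \<open>z\<close>. The lemma \<open>contact_point_quotients\<close> collects these facts about \<open>z\<close>.
\<close>

section \<open>First contact of a holomorphic function with the imaginary axis\<close>

lemma second_derivative_nonneg_at_minimum:
  fixes u u' :: "real \<Rightarrow> real"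
  assumes u: "\<And>t. (u has_real_derivative u' t) (at t)"
    and u'0: "u' 0 = 0"
    and u'': "(u' has_real_derivative c) (at 0)"
    and min: "\<And>t. u 0 \<le> u t"
  shows "0 \<le> c"
proof (rule ccontr)
  assume "\<not> 0 \<le> c"
  then obtain d where d: "d > 0" "\<And>h. h > 0 \<Longrightarrow> h < d \<Longrightarrow> u' (0 + h) < u' 0"
    using DERIV_neg_dec_right[OF u''] by force
  have "\<exists>z. 0 < z \<and> z < d/2 \<and> u (d/2) - u 0 = (d/2 - 0) * u' z"
    using d(1) u by (intro MVT2) auto
  then obtain z where z: "0 < z" "z < d/2" "u (d/2) - u 0 = d/2 * u' z" by auto
  have "u' z < 0" using d(2)[of z] z u'0 d(1) by auto
  then have "d/2 * u' z < 0" using d(1) by (simp add: mult_pos_neg)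
  with z(3) min[of "d/2"] show False by simp
qed

text \<open>
  The points of a closed disc at which the real part is at most 0 form a compact set, so one of
  them has least modulus. Nonnegativity on the circle through that point, and not only inside it, comes
  from continuity along radii; it is what makes the angular derivatives informative.
\<close>

lemma least_modulus_point_of_nonpos_real_part:
  assumes p: "p holomorphic_on unit_disc" and p0: "Re (p 0) > 0"
    and w: "w \<in> unit_disc" "Re (p w) \<le> 0"
  obtains z where "z \<in> unit_disc" "z \<noteq> 0" "Re (p z) = 0"
    "\<And>v. norm v \<le> norm z \<Longrightarrow> 0 \<le> Re (p v)"
proof -
  have sub: "cball 0 (norm w) \<subseteq> unit_disc" using w(1) by auto
  have cont: "continuous_on (cball 0 (norm w)) (\<lambda>z. Re (p z))"
    using holomorphic_on_imp_continuous_on[OF p] sub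
    by (intro continuous_intros) (rule continuous_on_subset)
  define K where "K = {z \<in> cball 0 (norm w). Re (p z) \<le> 0}"
  have K: "compact K"
  proof -
    have "closed K" unfolding K_def
      by (intro continuous_closed_preimage_constant continuous_on_closed_Collect_le closed_cball
          cont continuous_on_const)
    moreover have "bounded K" unfolding K_def
      by (rule bounded_subset[of "cball 0 (norm w)"]) auto
    ultimately show ?thesis by (simp add: compact_eq_bounded_closed)
  qed
  have "w \<in> K" using w by (simp add: K_def)
  then obtain z where z: "z \<in> K" and zmin: "\<And>v. v \<in> K \<Longrightarrow> norm z \<le> norm v"
    using continuous_attains_inf[OF K, of norm] continuous_on_norm_id by blast
  have zD: "z \<in> unit_disc" and z0: "z \<noteq> 0" and Rez: "Re (p z) \<le> 0"
    using z sub p0 by (auto simp: K_def)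
  have pos: "0 < Re (p v)" if "norm v < norm z" for v
    using zmin[of v] that z by (force simp: K_def)
  have nonneg: "0 \<le> Re (p v)" if "norm v \<le> norm z" for v
  proof (rule tendsto_lowerbound)
    have "isCont p v"
      using holomorphic_on_imp_continuous_on[OF p] that zD
      by (simp add: continuous_on_eq_continuous_at)
    then have "isCont p (of_real 1 * v)" by simp
    then have "isCont (\<lambda>t. Re (p (of_real t * v))) (1::real)"
      by (intro isCont_Re isCont_o2[where g = p and f = "\<lambda>t. of_real t * v"] continuous_intros)
    then have "((\<lambda>t. Re (p (of_real t * v))) \<longlongrightarrow> Re (p v)) (at (1::real))"
      by (simp add: isCont_def)
    then show "((\<lambda>t. Re (p (of_real t * v))) \<longlongrightarrow> Re (p v)) (at_left (1::real))"
      by (rule tendsto_mono[rotated]) (simp add: at_le)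
    have "\<forall>\<^sub>F t in at_left (1::real). 0 < t \<and> t < 1"
      by (intro eventually_at_leftI[of 0]) auto
    then show "\<forall>\<^sub>F t in at_left (1::real). 0 \<le> Re (p (of_real t * v))"
    proof eventually_elim
      case (elim t)
      have "t * norm v \<le> t * norm z" using elim that by simp
      also have "\<dots> < norm z" using elim z0 by simp
      finally show ?case using elim by (intro less_imp_le pos) (simp add: norm_mult)
    qed
  qed auto
  show ?thesis
    using that[OF zD z0 _ nonneg] nonneg[of z] Rez by simp
qed

lemma Re_along_curve_has_derivative:
  assumes "(c has_vector_derivative c') (at t)" "(g has_field_derivative g') (at (c t))"
  shows "((\<lambda>t. Re (g (c t))) has_real_derivative Re (c' * g')) (at t)"
  using has_field_derivative_Re[OF field_vector_diff_chain_at[OF assms]] by (simp only: o_def)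

text \<open>
  The hypotheses say that \<open>Re p\<close>, restricted to the closed disc of radius \<open>norm z\<close>, is minimal at
  \<open>z\<close>. The three conclusions are the necessary conditions for this from the first derivative along
  the circle, the first derivative along the radius, and the second derivative along the circle.
\<close>

lemma derivatives_at_first_imaginary_value:
  assumes p: "p holomorphic_on unit_disc" and z: "z \<in> unit_disc"
    and Rez: "Re (p z) = 0" and nonneg: "\<And>v. norm v \<le> norm z \<Longrightarrow> 0 \<le> Re (p v)"
  shows "Im (z * deriv p z) = 0" "Re (z * deriv p z) \<le> 0"
    "Re (z * deriv (\<lambda>w. w * deriv p w) z) \<le> 0"
proof -
  define D where "D = (\<lambda>w. w * deriv p w)"
  have Dhol: "D holomorphic_on unit_disc"
    unfolding D_def by (intro holomorphic_intros p) auto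
  have dp: "(p has_field_derivative deriv p w) (at w)" if "w \<in> unit_disc" for w
    using p that by (intro holomorphic_derivI[of _ unit_disc]) auto
  have dD: "(D has_field_derivative deriv D w) (at w)" if "w \<in> unit_disc" for w
    using Dhol that by (intro holomorphic_derivI[of _ unit_disc]) auto
  define c where "c = (\<lambda>t::real. z * exp (\<i> * of_real t))"
  have cD: "c t \<in> unit_disc" and nc: "norm (c t) = norm z" for t
    using z by (simp_all add: c_def norm_mult)
  have c0: "c 0 = z" by (simp add: c_def)
  have dc: "(c has_vector_derivative \<i> * c t) (at t)" for t
    unfolding c_def
    by (intro has_vector_derivative_real_field) (auto intro!: derivative_eq_intros)
  have along: "((\<lambda>t. Re (a * g (c t))) has_real_derivative Re (a * (\<i> * c t * deriv g (c t)))) (at t)"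
    if g: "g holomorphic_on unit_disc" for g t a
  proof (rule Re_along_curve_has_derivative[OF dc, THEN DERIV_cong])
    show "((\<lambda>z. a * g z) has_field_derivative a * deriv g (c t)) (at (c t))"
      using g cD[of t] by (intro DERIV_cmult holomorphic_derivI[of _ unit_disc]) auto
  qed (simp add: mult_ac)
  \<comment> \<open>Along the circle, \<open>d/dt\<close> acts as \<open>\<i>\<close> times the operator \<open>w d/dw\<close>, so differentiating twice
    produces \<open>\<i>\<^sup>2 = - 1\<close> and reverses the sign of the minimality condition.\<close>
  have 1: "((\<lambda>t. Re (p (c t))) has_real_derivative Re (\<i> * D (c t))) (at t)" for t
    using along[OF p, of 1 t] by (simp add: D_def mult.assoc)
  have 2: "((\<lambda>t. Re (\<i> * D (c t))) has_real_derivative Re (\<i> * (\<i> * c 0 * deriv D (c 0)))) (at 0)"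
    by (rule along[OF Dhol])
  have min: "Re (p (c 0)) \<le> Re (p (c t))" for t
    using nonneg[of "c t"] by (simp add: c0 Rez nc)
  have crit: "Re (\<i> * D (c 0)) = 0"
    using DERIV_local_min[OF 1, of 1] min by simp
  then show "Im (z * deriv p z) = 0" by (simp add: c0 D_def)
  have "0 \<le> Re (\<i> * (\<i> * c 0 * deriv D (c 0)))"
    by (rule second_derivative_nonneg_at_minimum[OF 1 crit 2 min])
  then show "Re (z * deriv (\<lambda>w. w * deriv p w) z) \<le> 0" by (simp add: c0 D_def)
  show "Re (z * deriv p z) \<le> 0"
  proof (rule ccontr)
    assume neg: "\<not> Re (z * deriv p z) \<le> 0"
    have "((\<lambda>t. Re (p (of_real t * z))) has_real_derivative Re (z * deriv p z)) (at 1)"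
    proof (rule Re_along_curve_has_derivative[where g = p and c = "\<lambda>t. of_real t * z"])
      show "((\<lambda>t. of_real t * z) has_vector_derivative z) (at 1)"
        by (intro has_vector_derivative_real_field) (auto intro!: derivative_eq_intros)
      show "(p has_field_derivative deriv p z) (at (of_real 1 * z))"
        using dp[OF z] by simp
    qed
    from DERIV_pos_inc_left[OF this] neg obtain d where
      d: "d > 0" "\<And>h. h > 0 \<Longrightarrow> h < d \<Longrightarrow> Re (p (of_real (1 - h) * z)) < Re (p (of_real 1 * z))"
      by force
    \<comment> \<open>The bound 1/2 only keeps \<open>1 - h\<close> positive.\<close>
    define h where "h = min (d/2) (1/2)"
    have "0 < h" "h < d" "h \<le> 1/2" using d(1) by (auto simp: h_def)
    moreover have "norm (of_real (1 - h) * z) \<le> norm z"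
    proof -
      have "norm (of_real (1 - h) * z) = (1 - h) * norm z"
        using \<open>h \<le> 1/2\<close> by (simp add: norm_mult del: of_real_diff)
      also have "\<dots> \<le> 1 * norm z" using \<open>0 < h\<close> by (intro mult_right_mono) auto
      finally show ?thesis by simp
    qed
    ultimately show False using d(2)[of h] nonneg[of "of_real (1 - h) * z"] Rez by simp
  qed
qed

section \<open>Relations between the three quotients\<close>

text \<open>
  The singularity at 0 is removed by dividing \<open>f'\<close> by the holomorphic extension of \<open>f(z) / z\<close>,
  which has no zero.
\<close>

lemma Q_ST_holomorphic:
  assumes f: "f \<in> class_A" and nz: "\<forall>z\<in>unit_disc. ff'_over_z f z \<noteq> 0"
  shows "Q_ST f holomorphic_on unit_disc"
proof -
  have fh: "f holomorphic_on unit_disc" and f0: "f 0 = 0" and f'0: "deriv f 0 = 1"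
    using f by (auto simp: class_A_def)
  define g where "g = (\<lambda>z. if z = 0 then deriv f 0 else (f z - f 0) / (z - 0))"
  have "g holomorphic_on unit_disc"
    unfolding g_def using fh by (rule pole_lemma_open) auto
  moreover have "g z \<noteq> 0" if "z \<in> unit_disc" for z
    using nz[rule_format, OF that] f0 f'0 by (auto simp: g_def ff'_over_z_def)
  moreover have "deriv f holomorphic_on unit_disc"
    using fh by (intro holomorphic_deriv) auto
  ultimately have "(\<lambda>z. deriv f z / g z) holomorphic_on unit_disc"
    by (intro holomorphic_on_divide) auto
  moreover have "Q_ST f = (\<lambda>z. deriv f z / g z)"
    by (auto simp: fun_eq_iff Q_ST_def g_def f0 f'0)
  ultimately show ?thesis by simp
qed

lemma Q_CV_eq_log_derivative_of_Q_ST: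
  assumes fh: "f holomorphic_on unit_disc" and z: "z \<in> unit_disc" "z \<noteq> 0"
    and nz: "f z \<noteq> 0" "deriv f z \<noteq> 0"
  shows "Q_CV f z = Q_ST f z + z * deriv (Q_ST f) z / Q_ST f z"
proof -
  have df: "(f has_field_derivative deriv f z) (at z)"
    using fh z by (intro holomorphic_derivI[of _ unit_disc]) auto
  have df': "(deriv f has_field_derivative deriv (deriv f) z) (at z)"
    using fh z by (intro holomorphic_derivI[of _ unit_disc] holomorphic_deriv) auto
  have "((\<lambda>z. z * deriv f z / f z) has_field_derivative
      ((deriv f z + z * deriv (deriv f) z) * f z - z * deriv f z * deriv f z) / (f z * f z)) (at z)"
    using nz by (auto intro!: derivative_eq_intros df df' simp: algebra_simps)
  then have "(Q_ST f has_field_derivative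
      ((deriv f z + z * deriv (deriv f) z) * f z - z * deriv f z * deriv f z) / (f z * f z)) (at z)"
    by (rule has_field_derivative_transform_within_open[of _ _ _ "- {0}"])
       (use z in \<open>auto simp: Q_ST_def\<close>)
  then have "deriv (Q_ST f) z =
      ((deriv f z + z * deriv (deriv f) z) * f z - z * deriv f z * deriv f z) / (f z * f z)"
    by (rule DERIV_imp_deriv)
  then show ?thesis using z nz by (simp add: Q_ST_def Q_CV_def field_simps)
qed

text \<open>
  With \<open>h = f'' / f'\<close> one has \<open>q = 1 + z h\<close>, so that the Schwarzian derivative \<open>h' - h\<^sup>2 / 2\<close> can be
  expressed by \<open>q\<close> and its derivative.
\<close>

lemma Q_SD_eq_Riccati_of_Q_CV:
  assumes fh: "f holomorphic_on unit_disc" and z: "z \<in> unit_disc" and nz: "deriv f z \<noteq> 0"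
  shows "Q_SD f z = z * deriv (Q_CV f) z + (1 - (Q_CV f z)\<^sup>2) / 2"
proof -
  define h where "h = (\<lambda>z. deriv (deriv f) z / deriv f z)"
  have "deriv f field_differentiable at z" "deriv (deriv f) field_differentiable at z"
    using fh z
    by (auto intro!: holomorphic_on_imp_differentiable_at[of _ unit_disc] holomorphic_deriv)
  then have "h field_differentiable at z"
    unfolding h_def using nz by (intro derivative_intros field_differentiable_divide) auto
  then have dh: "(h has_field_derivative deriv h z) (at z)"
    by (simp add: field_differentiable_derivI)
  have Q: "Q_CV f = (\<lambda>z. 1 + z * h z)" by (simp add: fun_eq_iff Q_CV_def h_def)
  have "((\<lambda>z. 1 + z * h z) has_field_derivative h z + z * deriv h z) (at z)"
    by (auto intro!: derivative_eq_intros dh)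
  then have "deriv (Q_CV f) z = h z + z * deriv h z" unfolding Q by (rule DERIV_imp_deriv)
  moreover have "Q_SD f z = z\<^sup>2 * (deriv h z - 1/2 * (h z)\<^sup>2)"
    by (simp add: Q_SD_def schwarzian_def h_def)
  ultimately show ?thesis unfolding Q by (simp add: power2_eq_square field_simps)
qed

lemma deriv_Q_CV:
  assumes f: "f \<in> class_A" and nz: "\<forall>z\<in>unit_disc. ff'_over_z f z \<noteq> 0"
    and z: "z \<in> unit_disc" "z \<noteq> 0"
  shows "z * deriv (Q_CV f) z = z * deriv (Q_ST f) z
    + z * deriv (\<lambda>w. w * deriv (Q_ST f) w) z / Q_ST f z - (z * deriv (Q_ST f) z)\<^sup>2 / (Q_ST f z)\<^sup>2"
proof -
  define p where "p = Q_ST f"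
  define D where "D = (\<lambda>w. w * deriv p w)"
  have fh: "f holomorphic_on unit_disc" using f by (simp add: class_A_def)
  have nz': "f w \<noteq> 0" "deriv f w \<noteq> 0" if "w \<in> unit_disc" "w \<noteq> 0" for w
    using nz[rule_format, OF that(1)] that(2) by (auto simp: ff'_over_z_def)
  have ph: "p holomorphic_on unit_disc" unfolding p_def by (rule Q_ST_holomorphic[OF f nz])
  then have Dh: "D holomorphic_on unit_disc"
    unfolding D_def by (intro holomorphic_intros) auto
  have dp: "(p has_field_derivative deriv p z) (at z)"
    and dD: "(D has_field_derivative deriv D z) (at z)"
    using ph Dh z by (auto intro!: holomorphic_derivI[of _ unit_disc])
  have pz: "p z \<noteq> 0" using z nz' by (simp add: p_def Q_ST_def)
  have "((\<lambda>w. p w + D w / p w) has_field_derivative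
      deriv p z + (deriv D z * p z - D z * deriv p z) / (p z * p z)) (at z)"
    using pz by (auto intro!: derivative_eq_intros dp dD)
  then have "(Q_CV f has_field_derivative
      deriv p z + (deriv D z * p z - D z * deriv p z) / (p z * p z)) (at z)"
    by (rule has_field_derivative_transform_within_open[of _ _ _ "unit_disc - {0}"])
       (use z fh nz' in \<open>auto simp: Q_CV_eq_log_derivative_of_Q_ST p_def D_def\<close>)
  then have d: "deriv (Q_CV f) z = deriv p z + (deriv D z * p z - D z * deriv p z) / (p z * p z)"
    by (rule DERIV_imp_deriv)
  have Dz: "D z = z * deriv p z" by (simp add: D_def)
  have "z * deriv (Q_CV f) z = z * deriv p z + z * deriv D z / p z - (z * deriv p z)\<^sup>2 / (p z)\<^sup>2"
    unfolding d Dz using pz by (simp add: power2_eq_square field_simps)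
  then show ?thesis by (simp only: p_def D_def)
qed

section \<open>The contact point\<close>

text \<open>
  Everything needed to refute the four inequalities at once: neither \<open>Q_ST\<close> nor \<open>Q_CV\<close> contributes
  to the real part at this point, and the quotients of \<open>Q_SD\<close> have the sign opposite to the one
  required when \<open>\<alpha> < 0\<close>.
\<close>

lemma contact_point_quotients:
  assumes f: "f \<in> class_A" and nz: "\<forall>z\<in>unit_disc. ff'_over_z f z \<noteq> 0"
    and "\<not> starlike_fun f"
  obtains z where "z \<in> unit_disc" "Re (Q_ST f z) = 0" "Re (Q_CV f z) = 0"
    "0 \<le> Re (Q_SD f z / Q_ST f z)" "0 \<le> Re (Q_SD f z / Q_CV f z)"
proof -
  define p where "p = Q_ST f"
  have fh: "f holomorphic_on unit_disc" using f by (simp add: class_A_def)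
  have ph: "p holomorphic_on unit_disc" unfolding p_def by (rule Q_ST_holomorphic[OF f nz])
  obtain w where w: "w \<in> unit_disc" "Re (p w) \<le> 0"
    using assms by (auto simp: starlike_fun_def p_def not_less)
  have "Re (p 0) > 0" by (simp add: p_def Q_ST_def)
  then obtain z where z: "z \<in> unit_disc" "z \<noteq> 0" and Rez: "Re (p z) = 0"
    and nonneg: "\<And>v. norm v \<le> norm z \<Longrightarrow> 0 \<le> Re (p v)"
    using least_modulus_point_of_nonpos_real_part[OF ph _ w] by blast
  note contact = derivatives_at_first_imaginary_value[OF ph z(1) Rez nonneg]
  have nz': "f z \<noteq> 0" "deriv f z \<noteq> 0" using nz[rule_format, OF z(1)] z(2) by (auto simp: ff'_over_z_def)
  define s where "s = Im (p z)"
  define m where "m = - Re (z * deriv p z)"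
  define X where "X = z * deriv (\<lambda>w. w * deriv p w) z"
  have ps: "p z = \<i> * of_real s" using Rez by (simp add: s_def complex_eq_iff)
  have D: "z * deriv p z = - of_real m" using contact(1) by (simp add: m_def complex_eq_iff)
  have m: "0 \<le> m" and X: "Re X \<le> 0" using contact by (simp_all add: m_def X_def)
  have s: "s \<noteq> 0" using ps z nz' by (auto simp: p_def Q_ST_def)
  define t where "t = (s\<^sup>2 + m) / s"
  have qt: "Q_CV f z = \<i> * of_real t"
  proof -
    have "Q_CV f z = \<i> * of_real s + - of_real m / (\<i> * of_real s)"
      using Q_CV_eq_log_derivative_of_Q_ST[OF fh z nz'] unfolding p_def[symmetric] D ps .
    also have "\<dots> = \<i> * of_real t"
      using s by (simp add: complex_eq_iff Re_divide Im_divide t_def field_simps power2_eq_square)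
    finally show ?thesis .
  qed
  have st: "s * t > 0" using s m by (simp add: t_def add_pos_nonneg)
  have "z * deriv (Q_CV f) z = - of_real m + X / (\<i> * of_real s) + of_real (m\<^sup>2 / s\<^sup>2)"
    using deriv_Q_CV[OF f nz z] unfolding p_def[symmetric] X_def[symmetric] D ps
    by (simp add: power_mult_distrib)
  \<comment> \<open>Only the term with \<open>X\<close> is not known to be real.\<close>
  then have "Im (z * deriv (Q_CV f) z) = - Re X / s"
    using s by (simp add: Im_divide power2_eq_square)
  moreover have "Im ((1 - (Q_CV f z)\<^sup>2) / 2) = 0"
    by (simp add: qt power_mult_distrib)
  ultimately have SD: "Im (Q_SD f z) = - Re X / s"
    using Q_SD_eq_Riccati_of_Q_CV[OF fh z(1) nz'(2)] by simp
  have quot: "Re (Q_SD f z / (\<i> * of_real r)) = - Re X / (s * r)" for r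
    by (simp add: Re_divide SD power2_eq_square)
  show ?thesis
  proof (rule that[OF z(1)])
    show "Re (Q_ST f z) = 0" using Rez by (simp add: p_def)
    show "Re (Q_CV f z) = 0" by (simp add: qt)
    show "0 \<le> Re (Q_SD f z / Q_ST f z)"
      using X by (simp only: ps[unfolded p_def] quot) (intro divide_nonneg_nonneg, auto)
    show "0 \<le> Re (Q_SD f z / Q_CV f z)"
      using X st by (simp only: qt quot) (intro divide_nonneg_nonneg, auto)
  qed
qed

theorem theorem2p15:
  fixes \<alpha> \<beta> :: real and f :: "complex \<Rightarrow> complex"
  assumes "\<alpha> < 0"
    and "f \<in> class_A"
    and "\<forall>z\<in>unit_disc. ff'_over_z f z \<noteq> 0"
    and "(\<forall>z\<in>unit_disc. Q_ST f z \<noteq> 0 \<and>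
            Re (of_real \<alpha> * (Q_SD f z / Q_ST f z) + of_real \<beta> * Q_ST f z) > 0) \<or>
         (\<forall>z\<in>unit_disc. Q_CV f z \<noteq> 0 \<and>
            Re (of_real \<alpha> * (Q_SD f z / Q_CV f z) + of_real \<beta> * Q_ST f z) > 0) \<or>
         (\<forall>z\<in>unit_disc. Q_ST f z \<noteq> 0 \<and>
            Re (of_real \<alpha> * (Q_SD f z / Q_ST f z) + of_real \<beta> * Q_CV f z) > 0) \<or>
         (\<forall>z\<in>unit_disc. Q_CV f z \<noteq> 0 \<and>
            Re (of_real \<alpha> * (Q_SD f z / Q_CV f z) + of_real \<beta> * Q_CV f z) > 0)"
  shows "starlike_fun f"
proof (rule ccontr)
  assume "\<not> starlike_fun f"
  with assms obtain z where z: "z \<in> unit_disc" "Re (Q_ST f z) = 0" "Re (Q_CV f z) = 0"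
    and quot: "0 \<le> Re (Q_SD f z / Q_ST f z)" "0 \<le> Re (Q_SD f z / Q_CV f z)"
    using contact_point_quotients by blast
  have le: "\<alpha> * Re (Q_SD f z / Q_ST f z) \<le> 0" "\<alpha> * Re (Q_SD f z / Q_CV f z) \<le> 0"
    using assms(1) quot by (simp_all add: mult_nonpos_nonneg)
  have Re_comb: "Re (of_real \<alpha> * v + of_real \<beta> * w) = \<alpha> * Re v + \<beta> * Re w" for v w
    by simp
  from assms(4) show False
    unfolding Re_comb using z le by (elim disjE) (drule(1) bspec, simp)+
qed

end
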